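(* Let $A\in\mathbb{R}^{n\times n}$ be invertible and symmetric, with distinct eigenvalues $a_1,\dots,a_p$ and, for each $i$, an orthonormal basis $u_{i,1},\dots,u_{i,n_i}$ of the eigenspace of $a_i$. Let $i_1\ne i_2$ in $\{1,\dots,p\}$ and suppose the initial residual of GMRES(1) applied to $Ax=b$ is $$r_0=\sum_{s=1}^{n_{i_1}}c_{i_1,s}u_{i_1,s}+\sum_{r=1}^{n_{i_2}}c_{i_2,r}u_{i_2,r},$$ with at least one $c_{i_1,s}$ nonzero and at least one $c_{i_2,r}$ nonzero. Then the corresponding root-convergence factor is $$\varrho(r_0)=\left(\frac{(a_{i_2}-a_{i_1})^2}{a_{i_1}^2+\epsilon_{i_1i_2}^2a_{i_2}^2}\cdot\frac{1}{1+\frac{1}{\epsilon_{i_1i_2}^2}}\right)^{1/2},\qquad \epsilon_{i_1i_2}^2=\frac{\sum_{r=1}^{n_{i_2}}c_{i_2,r}^2}{\sum_{s=1}^{n_{i_1}}c_{i_1,s}^2}.$$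
   Context: $\langle\cdot,\cdot\rangle$ and $\|\cdot\|$ are the Euclidean inner product and norm. For $v\neq 0$ put $\alpha(v)=\frac{\langle v,Av\rangle}{\langle Av,Av\rangle}$. GMRES(1) (minimal residual iteration) for $Ax=b$: given $x_0\in\mathbb{R}^n$, set $r_0=Ax_0-b$ and, for $k=0,1,2,\dots$, $x_{k+1}=x_k-\alpha(r_k)r_k$ and $r_{k+1}=r_k-\alpha(r_k)Ar_k$; if $r_k=0$ the iteration stops and one sets $r_m=0$ for all $m\ge k$. The root-convergence factor for the initial residual $r_0$ is $\varrho(r_0)=\limsup_{k\to\infty}\|r_k\|^{1/k}$. *)

theory Defs
  imports "HOL-Analysis.Analysis"
begin

definition eigenvalue :: "real^'n^'n \<Rightarrow> real \<Rightarrow> bool" where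
  "eigenvalue A a \<longleftrightarrow> (\<exists>v. v \<noteq> 0 \<and> A *v v = a *\<^sub>R v)"

definition eigenspace :: "real^'n^'n \<Rightarrow> real \<Rightarrow> (real^'n) set" where
  "eigenspace A a = {v. A *v v = a *\<^sub>R v}"

definition orthonormal_basis :: "(nat \<Rightarrow> 'a::euclidean_space) \<Rightarrow> nat \<Rightarrow> 'a set \<Rightarrow> bool" where
  "orthonormal_basis e m S \<longleftrightarrow>
     (\<forall>s\<in>{1..m}. \<forall>t\<in>{1..m}. e s \<bullet> e t = (if s = t then 1 else 0)) \<and>
     span (e ` {1..m}) = S"

definition gmres1_step_size :: "real^'n^'n \<Rightarrow> real^'n \<Rightarrow> real" where
  "gmres1_step_size A v = (v \<bullet> (A *v v)) / ((A *v v) \<bullet> (A *v v))"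

text \<open>The pair of iterate and residual after \<open>k\<close> steps.  The residual convention is
  \<open>A x - b\<close>.  Once the residual vanishes the iteration stops: the residual stays 0, and we keep
  the last iterate.\<close>

primrec gmres1 :: "real^'n^'n \<Rightarrow> real^'n \<Rightarrow> real^'n \<Rightarrow> nat \<Rightarrow> (real^'n) \<times> (real^'n)" where
  "gmres1 A b x0 0 = (x0, A *v x0 - b)"
| "gmres1 A b x0 (Suc k) =
     (let (x, r) = gmres1 A b x0 k in
      if r = 0 then (x, 0)
      else (x - gmres1_step_size A r *\<^sub>R r, r - gmres1_step_size A r *\<^sub>R (A *v r)))"

definition gmres1_residual :: "real^'n^'n \<Rightarrow> real^'n \<Rightarrow> real^'n \<Rightarrow> nat \<Rightarrow> real^'n" where
  "gmres1_residual A b x0 k = snd (gmres1 A b x0 k)"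

text \<open>The limit superior is taken in the extended reals, so that it is meaningful without any
  boundedness assumption.  The value of the sequence at \<open>k = 0\<close> is irrelevant.\<close>

definition root_convergence_factor :: "(nat \<Rightarrow> 'a::real_normed_vector) \<Rightarrow> ereal" where
  "root_convergence_factor r = limsup (\<lambda>k. ereal (norm (r k) powr (1 / real k)))"

end

theory Submission
  imports Defs
begin

text \<open>
  The residual is confined to the plane spanned by one eigenvector \<open>v\<close> for \<open>a i1\<close> and one
  eigenvector \<open>w\<close> for \<open>a i2\<close>, the components of the initial residual in the two eigenspaces, and
  these are orthogonal because \<open>A\<close> is symmetric.  Write \<open>V\<close>, \<open>W\<close> for their squared norms, \<open>x\<close>, \<open>y\<close>
  for the eigenvalues and \<open>D = x\<^sup>2 V + y\<^sup>2 W\<close>.  The step size minimises the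
  norm, so the new residual is orthogonal to \<open>A\<close> times the old one, which in a plane fixes its
  direction: after the first step it is \<open>(y - x) / D\<close> times \<open>y W v - x V w\<close>.  A second step must then lead back to the direction of
  \<open>v + w\<close>, with total factor \<open>q = (y - x)\<^sup>2 V W / (D (V + W))\<close>
  (\<open>residual_step_eigenvector_sum\<close>, \<open>residual_step_returns\<close>).

  So the residuals satisfy \<open>r (k + 2) = q r k\<close> with \<open>q > 0\<close> exactly, and neither \<open>r 0\<close> nor \<open>r 1\<close>
  vanishes.  Hence the norm of \<open>r k\<close> is \<open>(sqrt q) ^ k\<close> up to a factor that takes only two positive
  values, whose \<open>k\<close>-th root tends to \<open>1\<close> (\<open>root_convergence_factor_two_periodic\<close>).  Since
  \<open>eps\<^sup>2 = W / V\<close>, the number \<open>sqrt q\<close> is the claimed factor.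
\<close>

section \<open>One and two steps on a sum of two eigenvectors\<close>

definition residual_step :: "real^'n^'n \<Rightarrow> real^'n \<Rightarrow> real^'n" where
  "residual_step A v = v - gmres1_step_size A v *\<^sub>R (A *v v)"

text \<open>The stopping rule needs no separate treatment: a zero residual is a fixed point of the step.\<close>

lemma gmres1_residual_Suc:
  "gmres1_residual A b x0 (Suc k) = residual_step A (gmres1_residual A b x0 k)"
  by (simp add: gmres1_residual_def residual_step_def Let_def split: prod.split)

lemma residual_step_scaleR:
  "residual_step A (c *\<^sub>R v) = c *\<^sub>R residual_step A v"
proof (cases "c = 0")
  case False
  then have "gmres1_step_size A (c *\<^sub>R v) = gmres1_step_size A v"
    by (simp add: gmres1_step_size_def matrix_vector_mult_scaleR)
  then show ?thesis
    by (simp add: residual_step_def matrix_vector_mult_scaleR algebra_simps)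
qed (simp add: residual_step_def)

text \<open>The new residual is orthogonal to \<open>A (v + w) = x v + y w\<close>, hence a multiple of
  \<open>y W v - x V w\<close>.\<close>

lemma residual_step_eigenvector_sum:
  fixes A :: "real^'n^'n"
  assumes "A *v v = x *\<^sub>R v" and "A *v w = y *\<^sub>R w" and "v \<bullet> w = 0"
    and "v \<noteq> 0" and "x \<noteq> 0"
  defines "V \<equiv> v \<bullet> v" and "W \<equiv> w \<bullet> w"
  shows "residual_step A (v + w) =
    ((y - x) / (x\<^sup>2 * V + y\<^sup>2 * W)) *\<^sub>R ((y * W) *\<^sub>R v - (x * V) *\<^sub>R w)"
proof -
  define D where "D = x\<^sup>2 * V + y\<^sup>2 * W"
  have "D > 0"
    using assms(4,5) by (auto simp: D_def V_def W_def intro!: add_pos_nonneg)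
  have [simp]: "w \<bullet> v = 0"
    using assms(3) by (simp add: inner_commute)
  have image: "A *v (v + w) = x *\<^sub>R v + y *\<^sub>R w"
    by (simp add: assms(1,2) matrix_vector_right_distrib)
  have size: "gmres1_step_size A (v + w) = (x * V + y * W) / D"
    unfolding gmres1_step_size_def image
    by (simp add: assms(3) inner_simps V_def W_def D_def power2_eq_square)
  have coeff_v: "1 - (x * V + y * W) / D * x = (y - x) / D * (y * W)"
    using \<open>D > 0\<close> by (simp add: field_simps) (simp add: D_def power2_eq_square algebra_simps)
  have coeff_w: "1 - (x * V + y * W) / D * y = - ((y - x) / D * (x * V))"
    using \<open>D > 0\<close> by (simp add: field_simps) (simp add: D_def power2_eq_square algebra_simps)
  have "residual_step A (v + w) =
      (1 - (x * V + y * W) / D * x) *\<^sub>R v + (1 - (x * V + y * W) / D * y) *\<^sub>R w"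
    unfolding residual_step_def image size by (simp add: algebra_simps)
  also have "\<dots> = ((y - x) / D) *\<^sub>R ((y * W) *\<^sub>R v - (x * V) *\<^sub>R w)"
    unfolding coeff_v coeff_w by (simp add: algebra_simps)
  finally show ?thesis
    by (simp add: D_def)
qed

text \<open>The step from the second direction: its components are again eigenvectors, so the preceding
  lemma applies to \<open>y W v\<close> and \<open>- x V w\<close>, and the orthogonality relation leads back to
  the line of \<open>v + w\<close>.\<close>

lemma residual_step_returns:
  fixes A :: "real^'n^'n"
  assumes "A *v v = x *\<^sub>R v" and "A *v w = y *\<^sub>R w" and "v \<bullet> w = 0"
    and "v \<noteq> 0" and "w \<noteq> 0" and "x \<noteq> 0" and "y \<noteq> 0"
  defines "V \<equiv> v \<bullet> v" and "W \<equiv> w \<bullet> w"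
  shows "residual_step A ((y * W) *\<^sub>R v - (x * V) *\<^sub>R w) =
    ((y - x) * V * W / (V + W)) *\<^sub>R (v + w)"
proof -
  define v' w' where "v' = (y * W) *\<^sub>R v" and "w' = (- (x * V)) *\<^sub>R w"
  have pos: "V > 0" "W > 0" "V + W > 0"
    using assms(4,5) by (auto simp: V_def W_def intro: add_pos_pos)
  have V': "v' \<bullet> v' = y\<^sup>2 * W\<^sup>2 * V" and W': "w' \<bullet> w' = x\<^sup>2 * V\<^sup>2 * W"
    by (simp_all add: v'_def w'_def V_def W_def power2_eq_square)
  have D': "x\<^sup>2 * (y\<^sup>2 * W\<^sup>2 * V) + y\<^sup>2 * (x\<^sup>2 * V\<^sup>2 * W) = x\<^sup>2 * y\<^sup>2 * V * W * (V + W)"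
    by (simp add: power2_eq_square algebra_simps)
  have "residual_step A (v' + w') =
      ((y - x) / (x\<^sup>2 * y\<^sup>2 * V * W * (V + W))) *\<^sub>R
        ((y * (x\<^sup>2 * V\<^sup>2 * W)) *\<^sub>R v' - (x * (y\<^sup>2 * W\<^sup>2 * V)) *\<^sub>R w')"
  proof (subst residual_step_eigenvector_sum[of A v' x w' y, unfolded V' W' D'])
    show "A *v v' = x *\<^sub>R v'" "A *v w' = y *\<^sub>R w'"
      by (simp_all only: v'_def w'_def matrix_vector_mult_scaleR assms(1,2) scaleR_left_commute)
    show "v' \<bullet> w' = 0" "v' \<noteq> 0" "x \<noteq> 0"
      using assms pos by (simp_all add: v'_def w'_def)
  qed simp
  also have "\<dots> = ((y - x) / (x\<^sup>2 * y\<^sup>2 * V * W * (V + W)) * (x\<^sup>2 * y\<^sup>2 * V\<^sup>2 * W\<^sup>2)) *\<^sub>R (v + w)"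
    by (simp add: v'_def w'_def algebra_simps power2_eq_square)
  also have "(y - x) / (x\<^sup>2 * y\<^sup>2 * V * W * (V + W)) * (x\<^sup>2 * y\<^sup>2 * V\<^sup>2 * W\<^sup>2) =
      (y - x) * V * W / (V + W)"
    using pos assms(6,7) by (simp add: divide_simps) (simp add: power2_eq_square algebra_simps)
  finally show ?thesis
    by (simp add: v'_def w'_def)
qed

section \<open>Root-convergence factor of a two-periodic recursion\<close>

text \<open>Dividing \<open>norm (r k)\<close> by \<open>(sqrt q) ^ k\<close> leaves a positive quantity of period two, hence one
  bounded away from \<open>0\<close> and from infinity, and its \<open>k\<close>-th root tends to \<open>1\<close>.\<close>

lemma root_convergence_factor_two_periodic:
  fixes r :: "nat \<Rightarrow> 'a::real_normed_vector"
  assumes rec: "\<And>k. r (Suc (Suc k)) = q *\<^sub>R r k" and "q > 0" and "r 0 \<noteq> 0" and "r 1 \<noteq> 0"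
  shows "root_convergence_factor r = ereal (sqrt q)"
proof -
  define C where "C k = norm (r k) / sqrt q ^ k" for k
  have "C (Suc (Suc k)) = C k" for k
    using \<open>q > 0\<close> by (simp add: C_def rec field_simps flip: power2_eq_square)
  then have two_values: "C k \<in> {C 0, C 1}" for k
    by (induction k rule: induct_nat_012) auto
  define lo hi where "lo = min (C 0) (C 1)" and "hi = max (C 0) (C 1)"
  have bounds: "lo \<le> C k" "C k \<le> hi" for k
    using two_values[of k] by (auto simp: lo_def hi_def)
  have "lo > 0"
    using assms by (simp add: lo_def C_def)
  then have "hi > 0"
    using bounds[of 0] by linarith
  have "(\<lambda>k. C k powr (1 / real k)) \<longlonglongrightarrow> 1"
  proof (rule tendsto_sandwich)
    have "(\<lambda>k. d powr (1 / real k)) \<longlonglongrightarrow> d powr 0" if "d > 0" for d :: real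
      using that by (intro tendsto_powr tendsto_const lim_1_over_n) simp
    then show "(\<lambda>k. lo powr (1 / real k)) \<longlonglongrightarrow> 1" "(\<lambda>k. hi powr (1 / real k)) \<longlonglongrightarrow> 1"
      using \<open>lo > 0\<close> \<open>hi > 0\<close> by force+
  qed (use bounds \<open>lo > 0\<close> in \<open>auto intro!: always_eventually powr_mono2 intro: order.trans[OF less_imp_le]\<close>)
  then have "(\<lambda>k. sqrt q * C k powr (1 / real k)) \<longlonglongrightarrow> sqrt q * 1"
    by (intro tendsto_mult tendsto_const)
  moreover have "\<forall>\<^sub>F k in sequentially.
      sqrt q * C k powr (1 / real k) = norm (r k) powr (1 / real k)"
    using eventually_gt_at_top[of 0]
  proof eventually_elim
    case (elim k)
    have "norm (r k) = sqrt q ^ k * C k"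
      using \<open>q > 0\<close> by (simp add: C_def)
    moreover have "C k \<ge> 0"
      using bounds(1)[of k] \<open>lo > 0\<close> by linarith
    moreover have "(sqrt q ^ k) powr (1 / real k) = sqrt q"
      using \<open>q > 0\<close> elim by (simp add: powr_powr flip: powr_realpow)
    ultimately show ?case
      using \<open>q > 0\<close> by (simp add: powr_mult)
  qed
  ultimately have "(\<lambda>k. norm (r k) powr (1 / real k)) \<longlonglongrightarrow> sqrt q * 1"
    by (rule Lim_transform_eventually)
  then have "(\<lambda>k. ereal (norm (r k) powr (1 / real k))) \<longlonglongrightarrow> ereal (sqrt q)"
    by simp
  then show ?thesis
    unfolding root_convergence_factor_def
    by (rule lim_imp_Limsup[OF trivial_limit_sequentially])
qed

section \<open>The components of the initial residual\<close>

lemma symmetric_eigenvectors_orthogonal: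
  fixes A :: "real^'n^'n"
  assumes "transpose A = A" and "A *v v = x *\<^sub>R v" and "A *v w = y *\<^sub>R w" and "x \<noteq> y"
  shows "v \<bullet> w = 0"
proof -
  have "(A *v v) \<bullet> w = v \<bullet> (A *v w)"
    using assms(1) by (metis dot_lmul_matrix transpose_matrix_vector)
  then have "x * (v \<bullet> w) = y * (v \<bullet> w)"
    by (simp add: assms(2,3))
  then show ?thesis
    using assms(4) by simp
qed

lemma orthonormal_basis_combination_in:
  assumes "orthonormal_basis e m S"
  shows "(\<Sum>s=1..m. c s *\<^sub>R e s) \<in> S"
proof -
  have "(\<Sum>s=1..m. c s *\<^sub>R e s) \<in> span (e ` {1..m})"
    by (intro span_sum span_scale span_base imageI)
  then show ?thesis
    using assms by (simp only: orthonormal_basis_def)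
qed

lemma orthonormal_basis_combination_inner:
  assumes "orthonormal_basis e m S"
  shows "(\<Sum>s=1..m. c s *\<^sub>R e s) \<bullet> (\<Sum>s=1..m. c s *\<^sub>R e s) = (\<Sum>s=1..m. (c s)\<^sup>2)"
proof -
  have "(\<Sum>s=1..m. c s *\<^sub>R e s) \<bullet> (\<Sum>s=1..m. c s *\<^sub>R e s) =
      (\<Sum>s=1..m. \<Sum>t=1..m. c s * c t * (e s \<bullet> e t))"
    by (simp add: inner_sum_left inner_sum_right sum_distrib_left mult.assoc)
      (intro sum.cong refl, simp add: inner_commute)
  also have "\<dots> = (\<Sum>s=1..m. \<Sum>t=1..m. if s = t then (c s)\<^sup>2 else 0)"
    using assms unfolding orthonormal_basis_def
    by (intro sum.cong) (auto simp: power2_eq_square)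
  finally show ?thesis
    by simp
qed

section \<open>Convergence from two eigenvector components\<close>

text \<open>The root-convergence factor depends only on the two components of the initial residual, so
  it can be computed without choosing bases.\<close>

lemma root_convergence_factor_two_eigenvectors:
  fixes A :: "real^'n^'n"
  assumes start: "gmres1_residual A b x0 0 = v + w"
    and eig: "A *v v = x *\<^sub>R v" "A *v w = y *\<^sub>R w" and orth: "v \<bullet> w = 0"
    and nz: "v \<noteq> 0" "w \<noteq> 0" "x \<noteq> 0" "y \<noteq> 0" "x \<noteq> y"
  defines "V \<equiv> v \<bullet> v" and "W \<equiv> w \<bullet> w"
  shows "root_convergence_factor (gmres1_residual A b x0) =
    ereal (sqrt ((y - x)\<^sup>2 * V * W / ((x\<^sup>2 * V + y\<^sup>2 * W) * (V + W))))"
proof -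
  define D where "D = x\<^sup>2 * V + y\<^sup>2 * W"
  define z where "z = (y * W) *\<^sub>R v - (x * V) *\<^sub>R w"
  define q where "q = (y - x)\<^sup>2 * V * W / (D * (V + W))"
  let ?r = "gmres1_residual A b x0"
  have pos: "V > 0" "W > 0"
    using nz by (simp_all add: V_def W_def)
  then have "D > 0"
    using nz by (auto simp: D_def intro!: add_pos_pos)
  have step0: "residual_step A (v + w) = ((y - x) / D) *\<^sub>R z"
    unfolding D_def z_def V_def W_def
    by (rule residual_step_eigenvector_sum) (use assms in auto)
  have step1: "residual_step A z = ((y - x) * V * W / (V + W)) *\<^sub>R (v + w)"
    unfolding z_def V_def W_def
    by (rule residual_step_returns) (use assms in auto)
  have two_steps: "residual_step A (residual_step A (v + w)) = q *\<^sub>R (v + w)"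
    by (simp add: step0 step1 residual_step_scaleR q_def power2_eq_square)
  have two_steps': "residual_step A (residual_step A z) = q *\<^sub>R z"
    by (simp add: step0 step1 residual_step_scaleR q_def power2_eq_square mult_ac)
  \<comment> \<open>Every residual lies on one of the two lines through \<open>v + w\<close> and \<open>z\<close>; on both of them a pair
    of steps acts as multiplication by \<open>q\<close>.\<close>
  have on_lines: "\<exists>c. ?r k = c *\<^sub>R (v + w) \<or> ?r k = c *\<^sub>R z" for k
  proof (induction k)
    case 0
    show ?case
      using start by (intro exI[of _ 1]) simp
  next
    case (Suc k)
    then show ?case
      by (auto simp: gmres1_residual_Suc residual_step_scaleR step0 step1 simp flip: scaleR_right_distrib)
  qed
  have rec: "?r (Suc (Suc k)) = q *\<^sub>R ?r k" for k
  proof -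
    obtain c where "?r k = c *\<^sub>R (v + w) \<or> ?r k = c *\<^sub>R z"
      using on_lines by blast
    then show ?thesis
    proof
      assume *: "?r k = c *\<^sub>R (v + w)"
      show ?thesis
        unfolding gmres1_residual_Suc * residual_step_scaleR two_steps by (rule scaleR_left_commute)
    next
      assume *: "?r k = c *\<^sub>R z"
      show ?thesis
        unfolding gmres1_residual_Suc * residual_step_scaleR two_steps' by (rule scaleR_left_commute)
    qed
  qed
  have "(v + w) \<bullet> v = V" "z \<bullet> v = y * W * V"
    using orth by (simp_all add: inner_simps z_def V_def inner_commute)
  then have "v + w \<noteq> 0" "z \<noteq> 0"
    using pos nz by auto
  then have "?r 0 \<noteq> 0" "?r 1 \<noteq> 0"
    using nz \<open>D > 0\<close> by (simp_all add: start gmres1_residual_Suc step0)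
  moreover have "q > 0"
    using pos \<open>D > 0\<close> nz by (simp add: q_def)
  ultimately show ?thesis
    using root_convergence_factor_two_periodic[of ?r q, OF rec] by (simp add: q_def D_def)
qed

theorem corollary2p12:
  fixes A :: "real^'n^'n" and b x0 :: "real^'n"
    and p :: nat and a :: "nat \<Rightarrow> real" and m :: "nat \<Rightarrow> nat"
    and u :: "nat \<Rightarrow> nat \<Rightarrow> real^'n" and c :: "nat \<Rightarrow> nat \<Rightarrow> real"
    and i1 i2 :: nat and eps :: real
  assumes "invertible A" and "transpose A = A"
    and "inj_on a {1..p}" and "a ` {1..p} = {l. eigenvalue A l}"
    and "\<And>i. i \<in> {1..p} \<Longrightarrow> orthonormal_basis (u i) (m i) (eigenspace A (a i))"
    and "i1 \<in> {1..p}" and "i2 \<in> {1..p}" and "i1 \<noteq> i2"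
    and "gmres1_residual A b x0 0 =
           (\<Sum>s=1..m i1. c i1 s *\<^sub>R u i1 s) + (\<Sum>r=1..m i2. c i2 r *\<^sub>R u i2 r)"
    and "\<exists>s\<in>{1..m i1}. c i1 s \<noteq> 0" and "\<exists>r\<in>{1..m i2}. c i2 r \<noteq> 0"
    and "eps\<^sup>2 = (\<Sum>r=1..m i2. (c i2 r)\<^sup>2) / (\<Sum>s=1..m i1. (c i1 s)\<^sup>2)"
  shows "root_convergence_factor (gmres1_residual A b x0) =
           ereal (sqrt ((a i2 - a i1)\<^sup>2 / ((a i1)\<^sup>2 + eps\<^sup>2 * (a i2)\<^sup>2) * (1 / (1 + 1 / eps\<^sup>2))))"
proof -
  define v w where "v = (\<Sum>s=1..m i1. c i1 s *\<^sub>R u i1 s)" and "w = (\<Sum>r=1..m i2. c i2 r *\<^sub>R u i2 r)"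
  define V W where "V = (\<Sum>s=1..m i1. (c i1 s)\<^sup>2)" and "W = (\<Sum>r=1..m i2. (c i2 r)\<^sup>2)"
  let ?x = "a i1" and ?y = "a i2"
  have basis: "orthonormal_basis (u i1) (m i1) (eigenspace A ?x)"
      "orthonormal_basis (u i2) (m i2) (eigenspace A ?y)"
    using assms(5-7) by auto
  have norms: "v \<bullet> v = V" "w \<bullet> w = W"
    unfolding v_def w_def V_def W_def by (rule basis[THEN orthonormal_basis_combination_inner])+
  have pos: "V > 0" "W > 0"
    unfolding V_def W_def using assms(10,11) by (auto intro!: sum_pos2)
  then have nz: "v \<noteq> 0" "w \<noteq> 0"
    using norms by auto
  have eig: "A *v v = ?x *\<^sub>R v" "A *v w = ?y *\<^sub>R w"
    using orthonormal_basis_combination_in[OF basis(1), of "c i1"]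
      orthonormal_basis_combination_in[OF basis(2), of "c i2"]
    by (simp_all add: v_def w_def eigenspace_def)
  have inj: "inj ((*v) A)"
    using \<open>invertible A\<close> by (metis inj_matrix_vector_mult)
  have "?x \<noteq> 0" "?y \<noteq> 0"
    using eig nz injD[OF inj, of v 0] injD[OF inj, of w 0] by auto
  moreover have "?x \<noteq> ?y"
    using assms(3,6,7,8) by (auto dest: inj_onD)
  moreover have "v \<bullet> w = 0"
    using symmetric_eigenvectors_orthogonal[OF assms(2) eig] \<open>?x \<noteq> ?y\<close> by blast
  ultimately have "root_convergence_factor (gmres1_residual A b x0) =
      ereal (sqrt ((?y - ?x)\<^sup>2 * V * W / ((?x\<^sup>2 * V + ?y\<^sup>2 * W) * (V + W))))"
    using root_convergence_factor_two_eigenvectors[OF assms(9)[folded v_def w_def] eig] nz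
    by (simp add: norms)
  moreover have "(?y - ?x)\<^sup>2 * V * W / ((?x\<^sup>2 * V + ?y\<^sup>2 * W) * (V + W)) =
      (?y - ?x)\<^sup>2 / (?x\<^sup>2 + eps\<^sup>2 * ?y\<^sup>2) * (1 / (1 + 1 / eps\<^sup>2))"
  proof -
    have eps: "eps\<^sup>2 = W / V"
      using assms(12) by (simp add: V_def W_def)
    have "?x\<^sup>2 + eps\<^sup>2 * ?y\<^sup>2 = (?x\<^sup>2 * V + ?y\<^sup>2 * W) / V" "1 + 1 / eps\<^sup>2 = (V + W) / W"
      using pos unfolding eps by (simp_all add: field_simps)
    then show ?thesis
      by simp
  qed
  ultimately show ?thesis
    by simp
qed

end
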